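(* Let $\mathcal{E}=(V,\langle\cdot,\cdot\rangle)$ be a finite dimensional real inner product space and let $X$ be a centered random vector in $\mathcal{E}$ with positive definite covariance $\Sigma$. Let $C$ be a closed convex cone in $\mathcal{E}$. If $b\in \Sigma(C^* )\setminus(-C)$, where $\Sigma(C^* )$ denotes the linear image of $C^*$ under $\Sigma$, then $$\Pr\{X\succeq_C b\}\leq \frac{1}{1+\|b\|_{\Sigma^{-1}}^2},$$ where $\|b\|_{\Sigma^{-1}}=\sqrt{\langle b,\Sigma^{-1}(b)\rangle}$. Moreover, the bound is sharp, in the sense that there exists a centered random vector $X_0$ in $\mathcal{E}$ with covariance $\Sigma$ such that $\Pr\{X_0\succeq_C b\}=\left(1+\|b\|_{\Sigma^{-1}}^2\right)^{-1}$.
   Context: A random vector in $\mathcal{E}=(V,\langle\cdot,\cdot\rangle)$ is a measurable map $X$ from a probability space to $V$ equipped with its Borel $\sigma$-algebra. It is centered if $\mathbb{E}(\langle v,X\rangle)=0$ for all $v\in V$. If $\langle u,X\rangle$ has finite variance for every $u\in V$, the covariance of a centered random vector $X$ is the unique positive semi-definite self-adjoint endomorphism $\Sigma$ of $V$ with $\mathbb{E}(\langle u,X\rangle\langle v,X\rangle)=\langle u,\Sigma(v)\rangle$ for all $u,v\in V$; it is positive definite if $\langle u,\Sigma(u)\rangle>0$ for all $u\neq0$. A cone in $\mathcal{E}$ is a subset $C\subseteq V$ with $\lambda C\subseteq C$ for every $\lambda>0$; it is a convex cone if moreover $C+C\subseteq C$. By convention cones are non-empty and non-trivial (different from $\{0\}$).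 The dual of $C$ is $C^*=\{u\in V\mid \langle u,v\rangle\geq 0 \text{ for all } v\in C\}$. For $x,y\in V$, $y\succeq_C x$ means $y-x\in C$. *)

theory Defs
  imports "HOL-Probability.Probability"
begin

definition random_vector :: "'w measure \<Rightarrow> ('w \<Rightarrow> 'a::euclidean_space) \<Rightarrow> bool" where
  "random_vector M X \<longleftrightarrow> prob_space M \<and> X \<in> borel_measurable M"

(* Integrability is explicit because the Bochner integral of a non-integrable
   function is 0. *)
definition centered :: "'w measure \<Rightarrow> ('w \<Rightarrow> 'a::euclidean_space) \<Rightarrow> bool" where
  "centered M X \<longleftrightarrow>
     (\<forall>v. integrable M (\<lambda>\<omega>. v \<bullet> X \<omega>) \<and> (\<integral>\<omega>. v \<bullet> X \<omega> \<partial>M) = 0)"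

definition self_adjoint :: "('a::euclidean_space \<Rightarrow> 'a) \<Rightarrow> bool" where
  "self_adjoint S \<longleftrightarrow> linear S \<and> (\<forall>u v. S u \<bullet> v = u \<bullet> S v)"

definition pos_semidef :: "('a::euclidean_space \<Rightarrow> 'a) \<Rightarrow> bool" where
  "pos_semidef S \<longleftrightarrow> (\<forall>u. 0 \<le> u \<bullet> S u)"

definition pos_def :: "('a::euclidean_space \<Rightarrow> 'a) \<Rightarrow> bool" where
  "pos_def S \<longleftrightarrow> (\<forall>u. u \<noteq> 0 \<longrightarrow> 0 < u \<bullet> S u)"

(* S is the covariance of X, for centered X. As X has mean zero, the first
   conjunct says that every u \<bullet> X has finite variance; it also makes the
   products in the last conjunct integrable. *)
definition has_covariance ::
    "'w measure \<Rightarrow> ('w \<Rightarrow> 'a::euclidean_space) \<Rightarrow> ('a \<Rightarrow> 'a) \<Rightarrow> bool" where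
  "has_covariance M X S \<longleftrightarrow>
     (\<forall>u. integrable M (\<lambda>\<omega>. (u \<bullet> X \<omega>)\<^sup>2)) \<and>
     self_adjoint S \<and> pos_semidef S \<and>
     (\<forall>u v. (\<integral>\<omega>. (u \<bullet> X \<omega>) * (v \<bullet> X \<omega>) \<partial>M) = u \<bullet> S v)"

lemma has_covariance_unique:
  assumes "has_covariance M X S" and "has_covariance M X T"
  shows "S = T"
proof
  fix v
  have "u \<bullet> S v = u \<bullet> T v" for u
    using assms by (metis has_covariance_def)
  then show "S v = T v"
    using vector_eq_ldot by blast
qed

(* Unlike for the library predicate cone, only positive factors are required. *)
definition nontrivial_cone :: "'a::euclidean_space set \<Rightarrow> bool" where
  "nontrivial_cone C \<longleftrightarrow>
     C \<noteq> {} \<and> C \<noteq> {0} \<and> (\<forall>c>0. \<forall>x\<in>C. c *\<^sub>R x \<in> C)"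

definition nontrivial_convex_cone :: "'a::euclidean_space set \<Rightarrow> bool" where
  "nontrivial_convex_cone C \<longleftrightarrow>
     nontrivial_cone C \<and> (\<forall>x\<in>C. \<forall>y\<in>C. x + y \<in> C)"

definition dual_cone :: "'a::euclidean_space set \<Rightarrow> 'a set" where
  "dual_cone C = {u. \<forall>v\<in>C. 0 \<le> u \<bullet> v}"

definition cone_ge :: "'a::euclidean_space set \<Rightarrow> 'a \<Rightarrow> 'a \<Rightarrow> bool" where
  "cone_ge C y x \<longleftrightarrow> y - x \<in> C"

definition norm_wrt :: "('a::euclidean_space \<Rightarrow> 'a) \<Rightarrow> 'a \<Rightarrow> real" where
  "norm_wrt A b = sqrt (b \<bullet> A b)"

end

theory Submission
  imports Defs
begin

text \<open>
  Write \<open>b = S w\<close> with \<open>w\<close> in the dual cone and put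
  \<open>q = b \<bullet> w = b \<bullet> S\<^sup>-\<^sup>1 b\<close>. Since \<open>0 \<in> C\<close>, the hypothesis \<open>b \<notin> - C\<close> excludes \<open>b = 0\<close>,
  so \<open>q > 0\<close>.

  The bound: if \<open>X - b \<in> C\<close>, then \<open>w \<bullet> X \<ge> w \<bullet> b = q\<close>. The real random variable \<open>w \<bullet> X\<close> has
  mean \<open>0\<close> and variance \<open>w \<bullet> S w = q\<close>, so the one-sided Chebyshev inequality of Cantelli gives
  \<open>q / (q + q\<^sup>2) = 1 / (1 + q)\<close>.

  Sharpness: equality in Cantelli's inequality forces \<open>w \<bullet> X\<^sub>0\<close> to take the value \<open>q\<close> with
  probability \<open>p = 1 / (1 + q)\<close> and the value \<open>-1\<close> otherwise. This suggests letting \<open>X\<^sub>0\<close> be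
  \<open>b\<close> with probability \<open>p\<close>, and otherwise \<open>- b / q\<close> plus centered noise orthogonal to \<open>w\<close>. The
  total covariance is \<open>S\<close> when the noise has covariance \<open>(S - b b\<^sup>T / q) / (1 - p)\<close>. Such noise is
  obtained from \<open>X\<close> itself, without any factorisation of \<open>S\<close>: the \<open>S\<^sup>-\<^sup>1\<close>-orthogonal projection
  \<open>X - ((w \<bullet> X) / q) b\<close> has covariance \<open>S - b b\<^sup>T / q\<close>, and it only remains to scale it. The
  choice between the two cases is made by an independent coin, so \<open>X\<^sub>0\<close> is built on
  the product of a Bernoulli space with \<open>M\<close> and then replaced by its law on \<open>'a\<close>.
\<close>

section \<open>Cantelli's inequality\<close>

text \<open>
  Shifting by \<open>t = v / a\<close> before applying Markov's inequality to the square is the optimal choice: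
  it minimises \<open>(v + t\<^sup>2) / (a + t)\<^sup>2\<close> over \<open>t \<ge> 0\<close>.
\<close>

lemma (in prob_space) Cantelli_inequality:
  fixes Y :: "'a \<Rightarrow> real"
  assumes Y: "integrable M Y" "expectation Y = 0"
    and Y2: "integrable M (\<lambda>x. (Y x)\<^sup>2)" "expectation (\<lambda>x. (Y x)\<^sup>2) = v"
    and "a > 0"
  shows "prob {x \<in> space M. a \<le> Y x} \<le> v / (v + a\<^sup>2)"
proof -
  have v: "v \<ge> 0"
    using Y2 by (metis Bochner_Integration.integral_nonneg zero_le_power2)
  define t where "t = v / a"
  have t: "t \<ge> 0" and v_eq: "v = t * a"
    using v \<open>a > 0\<close> by (simp_all add: t_def)
  have [measurable]: "Y \<in> borel_measurable M"
    using Y(1) by simp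
  have expand: "(Y x + t)\<^sup>2 = (Y x)\<^sup>2 + 2 * t * Y x + t\<^sup>2" for x
    by (simp add: power2_sum)
  have int: "integrable M (\<lambda>x. (Y x + t)\<^sup>2)"
    unfolding expand using Y Y2 by simp
  have "prob {x \<in> space M. a \<le> Y x} \<le> prob {x \<in> space M. (a + t)\<^sup>2 \<le> (Y x + t)\<^sup>2}"
    using \<open>a > 0\<close> t by (intro finite_measure_mono) (auto intro!: power_mono)
  also have "\<dots> \<le> expectation (\<lambda>x. (Y x + t)\<^sup>2) / (a + t)\<^sup>2"
    using \<open>a > 0\<close> t by (intro integral_Markov_inequality_measure[OF int sets.empty_sets]) auto
  also have "expectation (\<lambda>x. (Y x + t)\<^sup>2) = v + t\<^sup>2"
    unfolding expand using Y Y2 by (simp add: prob_space)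
  also have "(v + t\<^sup>2) / (a + t)\<^sup>2 = v / (v + a\<^sup>2)"
  proof -
    have "v + t\<^sup>2 = t * (a + t)" "v + a\<^sup>2 = a * (a + t)"
      by (simp_all add: v_eq power2_eq_square algebra_simps)
    then show ?thesis
      using \<open>a > 0\<close> t by (simp add: v_eq power2_eq_square)
  qed
  finally show ?thesis .
qed

section \<open>Expectations over an independent coin\<close>

lemma (in prob_space) pair_bernoulli_expectation:
  fixes f :: "bool \<times> 'a \<Rightarrow> real"
  assumes p: "0 \<le> p" "p \<le> 1"
    and int: "\<And>c. integrable M (\<lambda>x. f (c, x))"
  shows "integrable (measure_pmf (bernoulli_pmf p) \<Otimes>\<^sub>M M) f" (is "integrable ?B f")
    and "integral\<^sup>L (measure_pmf (bernoulli_pmf p) \<Otimes>\<^sub>M M) f =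
      p * expectation (\<lambda>x. f (True, x)) + (1 - p) * expectation (\<lambda>x. f (False, x))"
proof -
  interpret B: pair_prob_space "measure_pmf (bernoulli_pmf p)" M ..
  have "f \<in> borel_measurable (count_space UNIV \<Otimes>\<^sub>M M)"
    using int by (intro measurable_pair_measure_countable1) auto
  then have meas: "f \<in> borel_measurable ?B"
    by (simp cong: measurable_cong_sets sets_pair_measure_cong)
  show int_f: "integrable ?B f"
    using int by (intro B.Fubini_integrable meas integrable_measure_pmf_finite)
      (auto intro: finite_subset[OF subset_UNIV])
  show "integral\<^sup>L ?B f =
      p * expectation (\<lambda>x. f (True, x)) + (1 - p) * expectation (\<lambda>x. f (False, x))"
    using B.integral_fst'[OF int_f] p by (simp add: mult.commute)
qed

section \<open>Second moments\<close>

lemma has_covariance_integrable_mult: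
  assumes "has_covariance M X S"
  shows "integrable M (\<lambda>\<omega>. (u \<bullet> X \<omega>) * (v \<bullet> X \<omega>))"
proof -
  have "(\<lambda>\<omega>. (u \<bullet> X \<omega>) * (v \<bullet> X \<omega>)) =
      (\<lambda>\<omega>. (((u + v) \<bullet> X \<omega>)\<^sup>2 - (u \<bullet> X \<omega>)\<^sup>2 - (v \<bullet> X \<omega>)\<^sup>2) / 2)"
    by (auto simp: inner_add_left power2_sum)
  moreover have "integrable M (\<lambda>\<omega>. (z \<bullet> X \<omega>)\<^sup>2)" for z
    using assms by (simp add: has_covariance_def)
  ultimately show ?thesis by simp
qed

text \<open>
  When the coin shows tails, the scalar projections of the extremal vector are of this affine form.
\<close>

lemma affine_product_expectation:
  assumes "random_vector M X" "centered M X" "has_covariance M X S"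
  shows "integrable M (\<lambda>\<omega>. (c + u \<bullet> X \<omega>) * (d + v \<bullet> X \<omega>))"
    and "(\<integral>\<omega>. (c + u \<bullet> X \<omega>) * (d + v \<bullet> X \<omega>) \<partial>M) = c * d + u \<bullet> S v"
proof -
  interpret prob_space M using assms by (simp add: random_vector_def)
  have expand: "(\<lambda>\<omega>. (c + u \<bullet> X \<omega>) * (d + v \<bullet> X \<omega>)) =
      (\<lambda>\<omega>. c * d + c * (v \<bullet> X \<omega>) + d * (u \<bullet> X \<omega>) + (u \<bullet> X \<omega>) * (v \<bullet> X \<omega>))"
    by (auto simp: algebra_simps)
  have lin: "integrable M (\<lambda>\<omega>. z \<bullet> X \<omega>)" "(\<integral>\<omega>. z \<bullet> X \<omega> \<partial>M) = 0" for z
    using assms by (auto simp: centered_def)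
  have quad: "integrable M (\<lambda>\<omega>. (u \<bullet> X \<omega>) * (v \<bullet> X \<omega>))"
      "(\<integral>\<omega>. (u \<bullet> X \<omega>) * (v \<bullet> X \<omega>) \<partial>M) = u \<bullet> S v"
    using has_covariance_integrable_mult[OF assms(3)] assms(3) by (auto simp: has_covariance_def)
  show "integrable M (\<lambda>\<omega>. (c + u \<bullet> X \<omega>) * (d + v \<bullet> X \<omega>))"
    unfolding expand using lin quad by simp
  show "(\<integral>\<omega>. (c + u \<bullet> X \<omega>) * (d + v \<bullet> X \<omega>) \<partial>M) = c * d + u \<bullet> S v"
    unfolding expand using lin quad by (simp add: prob_space)
qed

text \<open>
  Replacing a random vector by its law allows the extremal vector, which is built on a
  product space, to be realised on the space \<open>'a\<close>.
\<close>

lemma law_as_random_vector: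
  assumes X: "random_vector M X"
  defines "N \<equiv> distr M borel X"
  shows "random_vector N (\<lambda>x. x)"
    and "centered M X \<Longrightarrow> centered N (\<lambda>x. x)"
    and "has_covariance M X S \<Longrightarrow> has_covariance N (\<lambda>x. x) S"
    and "A \<in> sets borel \<Longrightarrow>
      measure N {x \<in> space N. x \<in> A} = measure M {\<omega> \<in> space M. X \<omega> \<in> A}"
proof -
  interpret prob_space M using X by (simp add: random_vector_def)
  have [measurable]: "X \<in> borel_measurable M" using X by (simp add: random_vector_def)
  show "random_vector N (\<lambda>x. x)"
    by (auto simp: random_vector_def N_def intro!: prob_space_distr)
  show "centered M X \<Longrightarrow> centered N (\<lambda>x. x)"
    by (auto simp: centered_def N_def integrable_distr_eq integral_distr)
  show "has_covariance M X S \<Longrightarrow> has_covariance N (\<lambda>x. x) S"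
    by (auto simp: has_covariance_def N_def integrable_distr_eq integral_distr)
  show "A \<in> sets borel \<Longrightarrow>
      measure N {x \<in> space N. x \<in> A} = measure M {\<omega> \<in> space M. X \<omega> \<in> A}"
    by (auto simp: N_def measure_distr intro!: arg_cong[where f = "measure M"])
qed

section \<open>The extremal random vector\<close>

text \<open>
  In the second branch, \<open>X \<omega> - ((w \<bullet> X \<omega>) / q) b\<close> is orthogonal to \<open>w\<close> and
  \<open>sqrt ((1 + q) / q)\<close> is \<open>1 / sqrt (1 - p)\<close> for the probability \<open>p = 1 / (1 + q)\<close> of the first
  branch; this factor compensates for the noise being present with probability \<open>1 - p\<close> only.
\<close>

definition extremal_vector ::
    "('w \<Rightarrow> 'a::euclidean_space) \<Rightarrow> 'a \<Rightarrow> 'a \<Rightarrow> bool \<times> 'w \<Rightarrow> 'a" where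
  "extremal_vector X w b = (\<lambda>(heads, \<omega>).
     let q = b \<bullet> w in
     if heads then b
     else - (1 / q) *\<^sub>R b + sqrt ((1 + q) / q) *\<^sub>R (X \<omega> - ((w \<bullet> X \<omega>) / q) *\<^sub>R b))"

lemma extremal_vector_True: "extremal_vector X w b (True, \<omega>) = b"
  by (simp add: extremal_vector_def)

lemma inner_extremal_vector_False:
  "u \<bullet> extremal_vector X w b (False, \<omega>) =
    - (u \<bullet> b) / (b \<bullet> w) +
    (sqrt ((1 + b \<bullet> w) / (b \<bullet> w)) *\<^sub>R (u - ((u \<bullet> b) / (b \<bullet> w)) *\<^sub>R w)) \<bullet> X \<omega>"
  by (simp add: extremal_vector_def Let_def inner_add_right inner_diff_right inner_diff_left
      mult.commute)

text \<open>
  Both branches contribute a multiple of \<open>(u \<bullet> b) (v \<bullet> b)\<close>: the jumps give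
  \<open>p + (1 - p) / q\<^sup>2 = 1 / q\<close>, which is exactly what the projection removes from \<open>S\<close>.
\<close>

lemma extremal_vector_moments:
  fixes X :: "'w \<Rightarrow> 'a::euclidean_space"
  assumes X: "random_vector M X" "centered M X" "has_covariance M X S"
    and b: "b = S w" and q: "b \<bullet> w > 0"
  defines "B \<equiv> measure_pmf (bernoulli_pmf (1 / (1 + b \<bullet> w))) \<Otimes>\<^sub>M M"
  shows "random_vector B (extremal_vector X w b)"
    and "centered B (extremal_vector X w b)"
    and "has_covariance B (extremal_vector X w b) S"
proof -
  interpret prob_space M using X by (simp add: random_vector_def)
  have [measurable]: "X \<in> borel_measurable M" using X by (simp add: random_vector_def)
  define q where "q = b \<bullet> w"
  define p where "p = 1 / (1 + q)"
  have q0: "q > 0" using assms by (simp add: q_def)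
  have p: "0 \<le> p" "p \<le> 1" using q0 by (simp_all add: p_def)
  have p': "1 - p = q * p" using q0 by (simp add: p_def field_simps)
  have B: "B = measure_pmf (bernoulli_pmf p) \<Otimes>\<^sub>M M"
    by (simp add: B_def p_def q_def)
  interpret B: pair_prob_space "measure_pmf (bernoulli_pmf p)" M ..
  let ?Y = "extremal_vector X w b"
  let ?k = "sqrt ((1 + q) / q)"
  define proj where "proj u = u - ((u \<bullet> b) / q) *\<^sub>R w" for u
  have False_eq: "u \<bullet> ?Y (False, \<omega>) = - (u \<bullet> b) / q + (?k *\<^sub>R proj u) \<bullet> X \<omega>" for u \<omega>
    by (simp only: inner_extremal_vector_False q_def proj_def)
  have S: "linear S" "S u \<bullet> v = u \<bullet> S v" for u v
    using X(3) by (auto simp: has_covariance_def self_adjoint_def)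
  have lin: "integrable M (\<lambda>\<omega>. z \<bullet> X \<omega>)" "(\<integral>\<omega>. z \<bullet> X \<omega> \<partial>M) = 0" for z
    using X by (auto simp: centered_def)

  have "?Y \<in> borel_measurable (count_space UNIV \<Otimes>\<^sub>M M)"
  proof (intro measurable_pair_measure_countable1)
    show "(\<lambda>\<omega>. ?Y (c, \<omega>)) \<in> borel_measurable M" for c
      by (cases c) (simp_all add: extremal_vector_def Let_def)
  qed simp
  then have meas: "?Y \<in> borel_measurable B"
    by (simp add: B cong: measurable_cong_sets sets_pair_measure_cong)
  then show "random_vector B ?Y"
    using B.prob_space_axioms by (simp add: random_vector_def B)

  show "centered B ?Y"
    unfolding centered_def
  proof (intro allI conjI)
    fix v
    \<comment> \<open>The scaled vector stays inside the inner product, so that \<open>lin\<close> applies to it as a whole.\<close>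
    have int: "integrable M (\<lambda>\<omega>. v \<bullet> ?Y (c, \<omega>))" for c
      by (cases c) (simp_all add: extremal_vector_True False_eq lin del: inner_scaleR_left)
    note E = pair_bernoulli_expectation[where f = "\<lambda>x. v \<bullet> ?Y x", OF p int, folded B]
    show "integrable B (\<lambda>x. v \<bullet> ?Y x)" by (rule E)
    have "(\<integral>x. v \<bullet> ?Y x \<partial>B) = p * (v \<bullet> b) + (1 - p) * (- (v \<bullet> b) / q)"
      using E(2) by (simp add: extremal_vector_True False_eq lin prob_space del: inner_scaleR_left)
    also have "\<dots> = 0"
      unfolding p' using q0 by simp
    finally show "(\<integral>x. v \<bullet> ?Y x \<partial>B) = 0" .
  qed

  have int2: "integrable M (\<lambda>\<omega>. (u \<bullet> ?Y (c, \<omega>)) * (v \<bullet> ?Y (c, \<omega>)))" for u v c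
  proof (cases c)
    case True
    then show ?thesis by (simp add: extremal_vector_True)
  next
    case False
    then show ?thesis
      by (simp only: False_eq affine_product_expectation(1)[OF X] not_True_eq_False)
  qed
  note E = pair_bernoulli_expectation[where f = "\<lambda>x. (u \<bullet> ?Y x) * (v \<bullet> ?Y x)" for u v,
      OF p int2, folded B]
  have proj_S: "proj u \<bullet> S (proj v) = u \<bullet> S v - (u \<bullet> b) * (v \<bullet> b) / q" for u v
  proof -
    have Sproj: "S (proj v) = S v - ((v \<bullet> b) / q) *\<^sub>R b"
      by (simp add: proj_def linear_diff[OF S(1)] linear_scale[OF S(1)] b)
    have "w \<bullet> S v = v \<bullet> b" "w \<bullet> b = q"
      using S(2)[of w v] by (simp_all add: b q_def inner_commute)
    then show ?thesis
      unfolding Sproj using q0 by (simp add: proj_def inner_simps field_simps)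
  qed
  have cov: "(\<integral>x. (u \<bullet> ?Y x) * (v \<bullet> ?Y x) \<partial>B) = u \<bullet> S v" for u v
  proof -
    have "(\<integral>\<omega>. (u \<bullet> ?Y (False, \<omega>)) * (v \<bullet> ?Y (False, \<omega>)) \<partial>M) =
        - (u \<bullet> b) / q * (- (v \<bullet> b) / q) + (?k *\<^sub>R proj u) \<bullet> S (?k *\<^sub>R proj v)"
      unfolding False_eq by (rule affine_product_expectation(2)[OF X])
    also have "(?k *\<^sub>R proj u) \<bullet> S (?k *\<^sub>R proj v) = (1 + q) / q * (proj u \<bullet> S (proj v))"
      using q0 by (simp add: linear_scale[OF S(1)] flip: mult.assoc)
    finally have noise: "(\<integral>\<omega>. (u \<bullet> ?Y (False, \<omega>)) * (v \<bullet> ?Y (False, \<omega>)) \<partial>M) =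
        (u \<bullet> b) * (v \<bullet> b) / q\<^sup>2 + (1 + q) / q * (u \<bullet> S v - (u \<bullet> b) * (v \<bullet> b) / q)"
      by (simp add: proj_S power2_eq_square)
    have "(\<integral>x. (u \<bullet> ?Y x) * (v \<bullet> ?Y x) \<partial>B) = p * ((u \<bullet> b) * (v \<bullet> b)) + (1 - p) *
        ((u \<bullet> b) * (v \<bullet> b) / q\<^sup>2 + (1 + q) / q * (u \<bullet> S v - (u \<bullet> b) * (v \<bullet> b) / q))"
      unfolding E(2) noise by (simp add: extremal_vector_True prob_space)
    also have "\<dots> = (p + (1 - p) / q\<^sup>2 - (1 - p) * (1 + q) / q / q) * ((u \<bullet> b) * (v \<bullet> b))
        + (1 - p) * (1 + q) / q * (u \<bullet> S v)"
      by (simp add: algebra_simps)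
    also have "(1 - p) * (1 + q) / q = 1"
      unfolding p' using q0 by (simp add: p_def)
    also have "p + (1 - p) / q\<^sup>2 - 1 / q = 0"
    proof -
      have "p + (1 - p) / q\<^sup>2 = p * (1 + q) / q"
        unfolding p' using q0 by (simp add: power2_eq_square field_simps)
      then show ?thesis using q0 by (simp add: p_def)
    qed
    finally show ?thesis by simp
  qed
  show "has_covariance B ?Y S"
    unfolding has_covariance_def
  proof (intro conjI allI cov)
    show "integrable B (\<lambda>x. (u \<bullet> ?Y x)\<^sup>2)" for u
      using E(1)[of u u] by (simp add: power2_eq_square)
    show "self_adjoint S" "pos_semidef S"
      using X(3) by (simp_all add: has_covariance_def)
  qed
qed

text \<open>
  When the coin shows tails, \<open>w \<bullet> (X\<^sub>0 - b)\<close> is the constant \<open>- 1 - b \<bullet> w < 0\<close>, whereas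
  \<open>w\<close> is nonnegative on the cone.
\<close>

lemma extremal_vector_cone_ge_iff:
  assumes "w \<in> dual_cone C" "0 \<in> C" "b \<bullet> w > 0"
  shows "cone_ge C (extremal_vector X w b (heads, \<omega>)) b \<longleftrightarrow> heads"
proof (cases heads)
  case True
  then show ?thesis
    using assms by (simp add: cone_ge_def extremal_vector_True)
next
  case False
  have "w \<bullet> extremal_vector X w b (False, \<omega>) = - 1"
    using assms(3) by (simp add: inner_extremal_vector_False inner_commute[of w b])
  then have "w \<bullet> (extremal_vector X w b (False, \<omega>) - b) < 0"
    using assms(3) by (simp add: inner_diff_right inner_commute[of w b])
  then show ?thesis
    using False assms(1) by (auto simp: cone_ge_def dual_cone_def not_le[symmetric])
qed

section \<open>The sharp bound\<close>

lemma closed_nontrivial_cone_zero_mem: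
  assumes "nontrivial_cone C" "closed C"
  shows "0 \<in> C"
proof -
  obtain x where "x \<in> C" and scale: "\<And>c. c > 0 \<Longrightarrow> c *\<^sub>R x \<in> C"
    using assms(1) by (auto simp: nontrivial_cone_def)
  have lim: "(\<lambda>n. inverse (real (Suc n)) *\<^sub>R x) \<longlonglongrightarrow> 0 *\<^sub>R x"
    by (intro tendsto_scaleR LIMSEQ_inverse_real_of_nat tendsto_const)
  have mem: "inverse (real (Suc n)) *\<^sub>R x \<in> C" for n
    by (rule scale) simp
  have "0 *\<^sub>R x \<in> C"
    by (rule closed_sequentially[OF assms(2) mem lim])
  then show ?thesis by simp
qed

lemma pos_def_inv_apply:
  assumes "linear S" "pos_def S"
  shows "inv S (S w) = w"
proof (rule inv_f_f)
  have "x = 0" if "S x = 0" for x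
    using that assms(2) by (force simp: pos_def_def)
  then show "inj S"
    using assms(1) by (simp add: linear_injective_0)
qed

theorem corollary4:
  fixes M :: "'w measure" and X :: "'w \<Rightarrow> 'a::euclidean_space"
    and S :: "'a \<Rightarrow> 'a" and C :: "'a set" and b :: 'a
  assumes "random_vector M X" and "centered M X"
    and "has_covariance M X S" and "pos_def S"
    and "nontrivial_convex_cone C" and "closed C"
    and "b \<in> S ` dual_cone C - uminus ` C"
  shows "measure M {\<omega> \<in> space M. cone_ge C (X \<omega>) b} \<le> 1 / (1 + (norm_wrt (inv S) b)\<^sup>2)
    \<and> (\<exists>(N :: 'a measure) (X\<^sub>0 :: 'a \<Rightarrow> 'a).
          random_vector N X\<^sub>0 \<and> centered N X\<^sub>0 \<and> has_covariance N X\<^sub>0 S \<and>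
          measure N {\<omega> \<in> space N. cone_ge C (X\<^sub>0 \<omega>) b} = inverse (1 + (norm_wrt (inv S) b)\<^sup>2))"
proof -
  interpret prob_space M using assms(1) by (simp add: random_vector_def)
  have [measurable]: "X \<in> borel_measurable M" using assms(1) by (simp add: random_vector_def)
  obtain w where w: "w \<in> dual_cone C" and b: "b = S w"
    using assms(7) by auto
  have linS: "linear S"
    using assms(3) by (simp add: has_covariance_def self_adjoint_def)
  have zero: "0 \<in> C"
    using assms(5,6) closed_nontrivial_cone_zero_mem[of C] by (simp add: nontrivial_convex_cone_def)
  define q where "q = b \<bullet> w"
  have "b \<noteq> 0"
    using zero assms(7) by force
  then have "w \<noteq> 0"
    using b linear_0[OF linS] by auto
  then have q0: "q > 0"
    using assms(4) by (simp add: q_def b pos_def_def inner_commute)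
  have norm: "(norm_wrt (inv S) b)\<^sup>2 = q"
    using q0 pos_def_inv_apply[OF linS assms(4), of w]
    by (simp add: norm_wrt_def q_def flip: b)

  have "measure M {\<omega> \<in> space M. cone_ge C (X \<omega>) b} \<le> prob {\<omega> \<in> space M. q \<le> w \<bullet> X \<omega>}"
    using w by (intro finite_measure_mono)
      (auto simp: cone_ge_def dual_cone_def q_def inner_diff_right inner_commute[of b w])
  also have "\<dots> \<le> q / (q + q\<^sup>2)"
  proof (rule Cantelli_inequality[OF _ _ _ _ q0])
    show "integrable M (\<lambda>\<omega>. w \<bullet> X \<omega>)" "expectation (\<lambda>\<omega>. w \<bullet> X \<omega>) = 0"
      using assms(2) by (simp_all add: centered_def)
    show "integrable M (\<lambda>\<omega>. (w \<bullet> X \<omega>)\<^sup>2)" "expectation (\<lambda>\<omega>. (w \<bullet> X \<omega>)\<^sup>2) = q"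
      using assms(3)
      by (simp_all add: has_covariance_def q_def b inner_commute power2_eq_square)
  qed
  also have "q / (q + q\<^sup>2) = 1 / (1 + q)"
  proof -
    have "q + q\<^sup>2 = q * (1 + q)"
      by (simp add: power2_eq_square algebra_simps)
    then show ?thesis using q0 by simp
  qed
  finally have bound: "measure M {\<omega> \<in> space M. cone_ge C (X \<omega>) b} \<le> 1 / (1 + q)" .

  define B where "B = measure_pmf (bernoulli_pmf (1 / (1 + q))) \<Otimes>\<^sub>M M"
  define Y where "Y = extremal_vector X w b"
  have Y: "random_vector B Y" "centered B Y" "has_covariance B Y S"
    using extremal_vector_moments[OF assms(1-3) b] q0 by (simp_all add: B_def Y_def q_def)
  let ?N = "distr B borel Y"
  let ?A = "{x. cone_ge C x b}"
  have "closed ?A"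
    unfolding cone_ge_def
    using assms(6) continuous_closed_vimage[of C "\<lambda>x. x - b"] by (simp add: vimage_def)
  then have "measure ?N {x \<in> space ?N. x \<in> ?A} = measure B {z \<in> space B. Y z \<in> ?A}"
    by (intro law_as_random_vector(4)[OF Y(1)]) simp
  also have "{z \<in> space B. Y z \<in> ?A} = {True} \<times> space M"
    by (auto simp: B_def Y_def space_pair_measure
        extremal_vector_cone_ge_iff[OF w zero q0[unfolded q_def]])
  also have "measure B \<dots> = inverse (1 + q)"
    using q0 by (simp add: B_def measure_def emeasure_pair_measure_Times emeasure_space_1
        emeasure_pmf_single inverse_eq_divide)
  finally have "measure ?N {x \<in> space ?N. cone_ge C x b} = inverse (1 + q)"
    by simp
  then have "\<exists>(N :: 'a measure) X\<^sub>0.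
      random_vector N X\<^sub>0 \<and> centered N X\<^sub>0 \<and> has_covariance N X\<^sub>0 S \<and>
      measure N {\<omega> \<in> space N. cone_ge C (X\<^sub>0 \<omega>) b} = inverse (1 + q)"
    using law_as_random_vector(1-3)[OF Y(1)] Y by blast
  with bound show ?thesis
    by (simp only: norm)
qed

end
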